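(* Let $k \ge 1$ be an integer and let $(X_m)_{m\ge 0}$ be a birth-death chain on the nonnegative integers with right-transition probabilities $(r_n)_{n\ge1}$ and left-transition probabilities $(l_n)_{n\ge1}$, where $r_n+l_n=1$ and $0<r_n<1$ for all $n\ge 1$, with $0$ absorbing and with $X_0=k$ almost surely. Set $t_0=1$ and $t_n=\frac{l_1l_2\cdots l_n}{r_1r_2\cdots r_n}$ for $n\ge1$. Let $P_k = P(X_m=0 \text{ for some } m)$ be the probability that the chain eventually hits $0$. Then $$P_k=\frac{\sum_{j=k}^\infty t_j}{\sum_{j=0}^\infty t_j},$$ where this quotient is interpreted as being equal to $1$ if the sums diverge.
   Context: A birth-death chain with parameters $(r_n)_{n\ge1}$, $(l_n)_{n\ge1}$ is a (time-homogeneous, discrete-time) Markov chain $(X_m)_{m\ge0}$ on $\{0,1,2,\dots\}$ whose transition probabilities are $p_{n,n+1}=r_n$, $p_{n,n-1}=l_n$, and $p_{nj}=0$ if $|n-j|\ne1$, for every $n\ge1$; and $p_{00}=1$ (the state $0$ is absorbing). *)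

theory Defs
  imports "HOL-Probability.Probability"
begin

text \<open>
  Time-homogeneous, discrete-time Markov chains on a countable state space. The conditional
  probability is the elementary one, so it is only constrained for histories of positive
  probability. The initial distribution is left open.
\<close>

locale markov_chain = prob_space M
  for M :: "'a measure" and p :: "'s::countable \<Rightarrow> 's \<Rightarrow> real" and X :: "nat \<Rightarrow> 'a \<Rightarrow> 's" +
  assumes random_variable_state: "\<And>m. X m \<in> measurable M (count_space UNIV)"
    and markov_property:
      "\<And>m x j. \<P>(\<omega> in M. \<forall>i\<le>m. X i \<omega> = x i) > 0 \<Longrightarrow>
         \<P>(\<omega> in M. X (Suc m) \<omega> = j \<bar> \<forall>i\<le>m. X i \<omega> = x i) = p (x m) j"

text \<open>The values \<open>r 0\<close> and \<open>l 0\<close> are irrelevant, as the state \<open>0\<close> is absorbing.\<close>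

definition birth_death_transition ::
    "(nat \<Rightarrow> real) \<Rightarrow> (nat \<Rightarrow> real) \<Rightarrow> nat \<Rightarrow> nat \<Rightarrow> real" where
  "birth_death_transition r l n j =
     (if n = 0 then (if j = 0 then 1 else 0)
      else if j = n + 1 then r n
      else if j = n - 1 then l n
      else 0)"

locale birth_death_chain = markov_chain M "birth_death_transition r l" X
  for M :: "'a measure" and r l :: "nat \<Rightarrow> real" and X :: "nat \<Rightarrow> 'a \<Rightarrow> nat"

definition bd_weight :: "(nat \<Rightarrow> real) \<Rightarrow> (nat \<Rightarrow> real) \<Rightarrow> nat \<Rightarrow> real" where
  "bd_weight r l n = (\<Prod>i=1..n. l i) / (\<Prod>i=1..n. r i)"

end

theory Submission
  imports Defs
begin

text \<open>
  The probability of absorption within \<open>i\<close> steps satisfies a first-step recursion, and its limit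
  \<open>h\<close> is the least nonnegative function with \<open>h 0 = 1\<close> that is harmonic off \<open>0\<close>. Harmonicity
  makes the increments of \<open>h\<close> proportional to the weights \<open>t\<^sub>n\<close>, so \<open>h n = 1 - c (t\<^sub>0 + \<dots> + t\<^sub>n\<^sub>-\<^sub>1)\<close>.
  Boundedness of \<open>h\<close> forces \<open>c = 0\<close> if \<open>\<Sum> t\<^sub>j\<close> diverges; if it converges, nonnegativity gives
  \<open>c \<le> 1 / \<Sum> t\<^sub>j\<close>, and minimality of \<open>h\<close> gives the reverse inequality.
\<close>

text \<open>Built from \<open>r\<close> and \<open>l\<close> alone, so that its limit can be
  computed without reference to a chain.\<close>

primrec bd_hit_within :: "(nat \<Rightarrow> real) \<Rightarrow> (nat \<Rightarrow> real) \<Rightarrow> nat \<Rightarrow> nat \<Rightarrow> real" where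
  "bd_hit_within r l 0 n = (if n = 0 then 1 else 0)"
| "bd_hit_within r l (Suc i) n =
     (if n = 0 then 1
      else r n * bd_hit_within r l i (n + 1) + l n * bd_hit_within r l i (n - 1))"

lemma bd_hit_within_0 [simp]: "bd_hit_within r l i 0 = 1"
  by (cases i) auto

section \<open>First-step analysis of the chain\<close>

lemma sums_birth_death_transition:
  assumes "n \<noteq> 0"
  shows "(\<lambda>j. birth_death_transition r l n j * f j) sums (r n * f (n + 1) + l n * f (n - 1))"
proof -
  have "(\<lambda>j. birth_death_transition r l n j * f j) sums
      (\<Sum>j\<in>{n + 1, n - 1}. birth_death_transition r l n j * f j)"
    using assms by (intro sums_finite) (auto simp: birth_death_transition_def)
  then show ?thesis
    using assms by (cases n) (simp_all add: birth_death_transition_def)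
qed

text \<open>Product form of the Markov property. It extends to null histories, where the conditional
  probability is unconstrained, because both sides are then zero.\<close>

lemma (in markov_chain) prob_history_step:
  "\<P>(\<omega> in M. (\<forall>i\<le>m. X i \<omega> = x i) \<and> X (Suc m) \<omega> = j) =
     \<P>(\<omega> in M. \<forall>i\<le>m. X i \<omega> = x i) * p (x m) j"
proof -
  note random_variable_state[measurable]
  let ?H = "\<lambda>\<omega>. \<forall>i\<le>m. X i \<omega> = x i"
  have H: "{\<omega> \<in> space M. ?H \<omega>} \<in> sets M" by measurable
  have le: "\<P>(\<omega> in M. ?H \<omega> \<and> X (Suc m) \<omega> = j) \<le> \<P>(\<omega> in M. ?H \<omega>)"
    by (rule finite_measure_mono[OF _ H]) auto
  show ?thesis
  proof (cases "\<P>(\<omega> in M. ?H \<omega>) = 0")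
    case True
    then show ?thesis using le by (simp add: measure_le_0_iff)
  next
    case False
    then have "\<P>(\<omega> in M. ?H \<omega>) > 0" by (simp add: zero_less_measure_iff)
    from markov_property[OF this, of j] False show ?thesis
      by (simp add: cond_prob_def divide_simps conj_commute)
  qed
qed

text \<open>The Markov property conditions on complete histories, so the induction on
  \<open>i\<close> keeps \<open>m\<close> and \<open>x\<close> arbitrary, extends the history by the
  next state and sums over that state.\<close>

lemma (in birth_death_chain) prob_history_hit_within:
  "\<P>(\<omega> in M. (\<forall>i\<le>m. X i \<omega> = x i) \<and> (\<exists>i'\<le>i. X (m + i') \<omega> = 0)) =
     \<P>(\<omega> in M. \<forall>i\<le>m. X i \<omega> = x i) * bd_hit_within r l i (x m)"
proof (cases "x m = 0")
  case True
  then have "{\<omega> \<in> space M. (\<forall>i\<le>m. X i \<omega> = x i) \<and> (\<exists>i'\<le>i. X (m + i') \<omega> = 0)} =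
      {\<omega> \<in> space M. \<forall>i\<le>m. X i \<omega> = x i}"
    by (force intro: exI[of _ 0])
  with True show ?thesis by simp
next
  case False
  then show ?thesis
  proof (induction i arbitrary: m x)
    case 0
    then have empty: "{\<omega> \<in> space M. (\<forall>i\<le>m. X i \<omega> = x i) \<and> (\<exists>i'\<le>0. X (m + i') \<omega> = 0)} = {}"
      by auto
    show ?case unfolding empty using 0 by simp
  next
    case (Suc i)
    note random_variable_state[measurable]
    let ?H = "\<lambda>m x \<omega>. \<forall>i\<le>m. X i \<omega> = x i"
    let ?T = "\<lambda>m i \<omega>. \<exists>i'\<le>i. X (m + i') \<omega> = 0"
    \<comment> \<open>As a function update, the longer history has the shape that the induction
      hypothesis expects.\<close>
    have split: "?H m x \<omega> \<and> X (Suc m) \<omega> = j \<longleftrightarrow> ?H (Suc m) (x(Suc m := j)) \<omega>" for j \<omega>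
      by (auto simp: le_Suc_eq)
    have step: "\<P>(\<omega> in M. ?H (Suc m) (x(Suc m := j)) \<omega> \<and> ?T (Suc m) i \<omega>) =
        \<P>(\<omega> in M. ?H m x \<omega>) * (birth_death_transition r l (x m) j * bd_hit_within r l i j)" for j
    proof -
      have "\<P>(\<omega> in M. ?H (Suc m) (x(Suc m := j)) \<omega> \<and> ?T (Suc m) i \<omega>) =
          \<P>(\<omega> in M. ?H (Suc m) (x(Suc m := j)) \<omega>) * bd_hit_within r l i j"
      \<comment> \<open>The induction hypothesis covers only nonzero current states; for
        \<open>j = 0\<close> the hit occurs at offset \<open>0\<close>.\<close>
      proof (cases "j = 0")
        case True
        have "{\<omega> \<in> space M. ?H (Suc m) (x(Suc m := j)) \<omega> \<and> ?T (Suc m) i \<omega>} =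
            {\<omega> \<in> space M. ?H (Suc m) (x(Suc m := j)) \<omega>}"
          using True by (auto intro!: exI[of _ 0])
        with True show ?thesis by simp
      next
        case False
        then show ?thesis using Suc.IH[of "x(Suc m := j)" "Suc m"] by simp
      qed
      also have "\<P>(\<omega> in M. ?H (Suc m) (x(Suc m := j)) \<omega>) =
          \<P>(\<omega> in M. ?H m x \<omega>) * birth_death_transition r l (x m) j"
        unfolding split[symmetric] by (rule prob_history_step)
      finally show ?thesis by simp
    qed
    \<comment> \<open>Since \<open>x m \<noteq> 0\<close>, there is no hit at time \<open>m\<close>,
      so \<open>Suc i\<close> steps from \<open>m\<close> amount to \<open>i\<close> steps from
      \<open>Suc m\<close>.\<close>
    have shift: "?T m (Suc i) \<omega> \<longleftrightarrow> ?T (Suc m) i \<omega>" if "?H m x \<omega>" for \<omega>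
    proof
      assume "?T m (Suc i) \<omega>"
      then obtain i' where i': "i' \<le> Suc i" "X (m + i') \<omega> = 0" by blast
      moreover have "i' \<noteq> 0" using i'(2) that Suc.prems by (intro notI) simp
      ultimately show "?T (Suc m) i \<omega>" by (intro exI[of _ "i' - 1"]) auto
    next
      assume "?T (Suc m) i \<omega>"
      then show "?T m (Suc i) \<omega>" by (metis Suc_le_mono add_Suc_shift)
    qed
    have "(\<lambda>j. \<P>(\<omega> in M. ?H (Suc m) (x(Suc m := j)) \<omega> \<and> ?T (Suc m) i \<omega>)) sums
        \<P>(\<omega> in M. ?H m x \<omega> \<and> ?T m (Suc i) \<omega>)"
    \<comment> \<open>The events are disjoint: the only possible \<open>j\<close> is
      \<open>X (Suc m) \<omega>\<close>.\<close>
    proof (rule prob_sums)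
      show "AE \<omega> in M.
          (\<forall>j. ?H (Suc m) (x(Suc m := j)) \<omega> \<and> ?T (Suc m) i \<omega> \<longrightarrow>
             ?H m x \<omega> \<and> ?T m (Suc i) \<omega>) \<and>
          (?H m x \<omega> \<and> ?T m (Suc i) \<omega> \<longrightarrow>
             (\<exists>!j. ?H (Suc m) (x(Suc m := j)) \<omega> \<and> ?T (Suc m) i \<omega>))"
        unfolding split[symmetric] using shift by (intro AE_I2) blast
    qed measurable
    moreover have "(\<lambda>j. \<P>(\<omega> in M. ?H (Suc m) (x(Suc m := j)) \<omega> \<and> ?T (Suc m) i \<omega>)) sums
        (\<P>(\<omega> in M. ?H m x \<omega>) * bd_hit_within r l (Suc i) (x m))"
      unfolding step using Suc.prems
      by (intro sums_mult) (simp add: sums_birth_death_transition[simplified])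
    ultimately show ?case by (rule sums_unique2)
  qed
qed

text \<open>The events of absorption by time \<open>i\<close> increase to eventual absorption, so
  continuity from below applies.\<close>

lemma (in birth_death_chain) bd_hit_within_tendsto:
  assumes "AE \<omega> in M. X 0 \<omega> = k"
  shows "(\<lambda>i. bd_hit_within r l i k) \<longlonglongrightarrow> \<P>(\<omega> in M. \<exists>m. X m \<omega> = 0)"
proof -
  note random_variable_state[measurable]
  have start: "\<P>(\<omega> in M. X 0 \<omega> = k) = 1"
    using assms by (simp add: prob_Collect_eq_1)
  have "\<P>(\<omega> in M. \<exists>i'\<le>i. X i' \<omega> = 0) = bd_hit_within r l i k" for i
  proof -
    have "\<P>(\<omega> in M. \<exists>i'\<le>i. X i' \<omega> = 0) =
        \<P>(\<omega> in M. X 0 \<omega> = k \<and> (\<exists>i'\<le>i. X i' \<omega> = 0))"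
      by (rule finite_measure_eq_AE) (use assms in auto)
    with prob_history_hit_within[of 0 "\<lambda>_. k" i] start show ?thesis by simp
  qed
  moreover have "(\<lambda>i. \<P>(\<omega> in M. \<exists>i'\<le>i. X i' \<omega> = 0)) \<longlonglongrightarrow>
      measure M (\<Union>i. {\<omega> \<in> space M. \<exists>i'\<le>i. X i' \<omega> = 0})"
    by (rule finite_Lim_measure_incseq) (auto simp: incseq_def intro: order_trans)
  moreover have "(\<Union>i. {\<omega> \<in> space M. \<exists>i'\<le>i. X i' \<omega> = 0}) = {\<omega> \<in> space M. \<exists>m. X m \<omega> = 0}"
    by auto
  ultimately show ?thesis by simp
qed

section \<open>Weights and harmonic functions\<close>

lemma bd_weight_0 [simp]: "bd_weight r l 0 = 1"
  by (simp add: bd_weight_def)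

lemma bd_weight_Suc: "bd_weight r l (Suc n) = bd_weight r l n * (l (Suc n) / r (Suc n))"
  by (simp add: bd_weight_def)

lemma bd_weight_pos:
  assumes "\<And>n. n \<ge> 1 \<Longrightarrow> r n > 0" "\<And>n. n \<ge> 1 \<Longrightarrow> l n > 0"
  shows "bd_weight r l n > 0"
  unfolding bd_weight_def using assms by (intro divide_pos_pos prod_pos) auto

text \<open>Replacing \<open>h n\<close> by \<open>(r n + l n) * h n\<close> shows that each
  decrement of \<open>h\<close> is \<open>l n / r n\<close> times the preceding one; the decrements
  then telescope.\<close>

lemma harmonic_eq_sum_bd_weight:
  fixes h :: "nat \<Rightarrow> real"
  assumes rl: "\<And>n. n \<ge> 1 \<Longrightarrow> r n + l n = 1"
    and r: "\<And>n. n \<ge> 1 \<Longrightarrow> r n > 0"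
    and h: "\<And>n. n \<ge> 1 \<Longrightarrow> h n = r n * h (n + 1) + l n * h (n - 1)"
  shows "h n = h 0 - (\<Sum>j<n. bd_weight r l j) * (h 0 - h 1)"
proof -
  have diff: "h n - h (Suc n) = bd_weight r l n * (h 0 - h 1)" for n
  proof (induction n)
    case (Suc n)
    let ?a = "r (Suc n)" and ?b = "l (Suc n)"
    have "(?a + ?b) * h (Suc n) = ?a * h (Suc (Suc n)) + ?b * h n"
      using h[of "Suc n"] rl[of "Suc n"] by simp
    then have "?a * (h (Suc n) - h (Suc (Suc n))) = ?b * (h n - h (Suc n))"
      by (simp add: algebra_simps)
    then have "h (Suc n) - h (Suc (Suc n)) = (?b / ?a) * (h n - h (Suc n))"
      using r[of "Suc n"] by (simp add: field_simps)
    then show ?case by (simp add: Suc.IH bd_weight_Suc)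
  qed simp
  show ?thesis
  proof (induction n)
    case (Suc n)
    then show ?case using diff[of n] by (simp add: algebra_simps)
  qed simp
qed

text \<open>A converse, supplying comparison functions for the minimality argument. It rests on the
  balance between \<open>r n\<close> times the weight at \<open>n\<close> and \<open>l n\<close>
  times the weight at \<open>n - 1\<close>.\<close>

lemma harmonic_one_minus_sum_bd_weight:
  fixes c :: real
  assumes rl: "r n + l n = 1" and r: "r n > 0" and n: "n \<ge> 1"
  defines "g \<equiv> \<lambda>n. 1 - c * (\<Sum>j<n. bd_weight r l j)"
  shows "g n = r n * g (n + 1) + l n * g (n - 1)"
proof -
  obtain m where m: "n = Suc m" using n by (cases n) auto
  have "r n * bd_weight r l n = l n * bd_weight r l m"
    using r by (simp add: m bd_weight_Suc)
  moreover have "g n = (r n + l n) * g n" by (simp add: rl)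
  ultimately show ?thesis by (simp add: g_def m algebra_simps)
qed

text \<open>Minimality: the recursion starts from the indicator of \<open>0\<close>, which lies
  below \<open>g\<close>, and its step is monotone and fixes \<open>g\<close>.\<close>

lemma bd_hit_within_le_harmonic:
  assumes "\<And>n. n \<ge> 1 \<Longrightarrow> r n \<ge> 0" "\<And>n. n \<ge> 1 \<Longrightarrow> l n \<ge> 0"
    and "\<And>n. g n \<ge> 0" "g 0 = 1"
    and "\<And>n. n \<ge> 1 \<Longrightarrow> g n = r n * g (n + 1) + l n * g (n - 1)"
  shows "bd_hit_within r l i n \<le> g n"
proof (induction i arbitrary: n)
  case 0
  then show ?case using assms(3,4) by simp
next
  case (Suc i)
  show ?case
  proof (cases "n = 0")
    case False
    then have "bd_hit_within r l (Suc i) n \<le> r n * g (n + 1) + l n * g (n - 1)"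
      using assms(1,2)[of n] Suc.IH by (auto intro!: add_mono mult_left_mono)
    with False assms(5)[of n] show ?thesis by simp
  qed (use assms(4) in simp)
qed

lemma bd_hit_within_nonneg:
  assumes "\<And>n. n \<ge> 1 \<Longrightarrow> r n \<ge> 0" "\<And>n. n \<ge> 1 \<Longrightarrow> l n \<ge> 0"
  shows "bd_hit_within r l i n \<ge> 0"
  using assms by (induction i arbitrary: n) (auto intro!: add_nonneg_nonneg mult_nonneg_nonneg)

lemma bd_hit_within_mono:
  assumes "\<And>n. n \<ge> 1 \<Longrightarrow> r n \<ge> 0" "\<And>n. n \<ge> 1 \<Longrightarrow> l n \<ge> 0"
  shows "bd_hit_within r l i n \<le> bd_hit_within r l (Suc i) n"
proof (induction i arbitrary: n)
  case 0
  have "bd_hit_within r l 1 n \<ge> 0" using assms by (rule bd_hit_within_nonneg)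
  then show ?case by (cases "n = 0") auto
next
  case (Suc i)
  show ?case
  proof (cases "n = 0")
    case False
    then show ?thesis
      using assms(1,2)[of n] Suc.IH
      \<comment> \<open>Only the outer layer is unfolded on each side; the default rules would also
        unfold the inner \<open>Suc i\<close> and miss the induction hypothesis.\<close>
      by (auto simp: bd_hit_within.simps(2)[of r l "Suc i" n] bd_hit_within.simps(2)[of r l i n]
          simp del: bd_hit_within.simps intro!: add_mono mult_left_mono)
  qed simp
qed

lemma bd_hit_within_limit:
  assumes rl: "\<And>n. n \<ge> 1 \<Longrightarrow> r n + l n = 1"
    and r: "\<And>n. n \<ge> 1 \<Longrightarrow> 0 < r n \<and> r n < 1"
  shows "(\<lambda>i. bd_hit_within r l i k) \<longlonglongrightarrow>
    (if summable (bd_weight r l)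
     then (\<Sum>j. bd_weight r l (j + k)) / (\<Sum>j. bd_weight r l j)
     else 1)"
proof -
  let ?t = "bd_weight r l" and ?f = "bd_hit_within r l"
  let ?S = "\<lambda>n. \<Sum>j<n. ?t j"
  have r0: "r n > 0" and l0: "l n > 0" if "n \<ge> 1" for n
    using rl[OF that] r[OF that] by auto
  have t0: "?t n > 0" for n using r0 l0 by (rule bd_weight_pos)
  \<comment> \<open>The constant function \<open>1\<close> serves as \<open>g\<close>, being
    harmonic because \<open>r n + l n = 1\<close>.\<close>
  have f1: "?f i n \<le> 1" for i n
    by (rule bd_hit_within_le_harmonic) (use r0 l0 rl in \<open>auto intro: less_imp_le\<close>)
  have f0: "0 \<le> ?f i n" for i n
    by (rule bd_hit_within_nonneg) (use r0 l0 in \<open>auto intro: less_imp_le\<close>)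
  have "\<exists>L. (\<lambda>i. ?f i n) \<longlonglongrightarrow> L" for n
  proof -
    have "incseq (\<lambda>i. ?f i n)"
      by (rule incseq_SucI, rule bd_hit_within_mono) (use r0 l0 in \<open>auto intro: less_imp_le\<close>)
    then show ?thesis using f1 by (metis incseq_convergent)
  qed
  then obtain h where lim: "\<And>n. (\<lambda>i. ?f i n) \<longlonglongrightarrow> h n" by metis
  have h0: "h 0 = 1" using lim[of 0] by (simp add: LIMSEQ_const_iff)
  have h_nonneg: "h n \<ge> 0" for n by (rule LIMSEQ_le_const[OF lim]) (use f0 in auto)
  have h_harmonic: "h n = r n * h (n + 1) + l n * h (n - 1)" if "n \<ge> 1" for n
  proof (rule LIMSEQ_unique)
    show "(\<lambda>i. ?f (Suc i) n) \<longlonglongrightarrow> h n" using lim by (rule LIMSEQ_Suc)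
    have "(\<lambda>i. r n * ?f i (n + 1) + l n * ?f i (n - 1)) \<longlonglongrightarrow> r n * h (n + 1) + l n * h (n - 1)"
      by (intro tendsto_intros lim)
    then show "(\<lambda>i. ?f (Suc i) n) \<longlonglongrightarrow> r n * h (n + 1) + l n * h (n - 1)"
      using that by simp
  qed
  define c where "c = 1 - h 1"
  have h: "h n = 1 - c * ?S n" for n
    using harmonic_eq_sum_bd_weight[OF rl r0 h_harmonic, of n] h0
    by (simp add: c_def mult.commute)
  have c_nonneg: "c \<ge> 0"
    unfolding c_def using LIMSEQ_le_const2[OF lim, of 1 1] f1 by auto
  have "h k = (if summable ?t then (\<Sum>j. ?t (j + k)) / (\<Sum>j. ?t j) else 1)"
  proof (cases "summable ?t")
    case True
    let ?T = "\<Sum>j. ?t j"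
    have T0: "?T > 0" using True t0 by (intro suminf_pos)
    have "c * ?T \<le> 1"
    proof (rule LIMSEQ_le_const2)
      show "(\<lambda>n. c * ?S n) \<longlonglongrightarrow> c * ?T"
        using True by (intro tendsto_intros summable_LIMSEQ)
      show "\<exists>N. \<forall>n\<ge>N. c * ?S n \<le> 1" using h h_nonneg by (metis diff_ge_0_iff_ge)
    qed
    moreover have "1 \<le> c * ?T"
    proof -
      \<comment> \<open>The slope \<open>1 / ?T\<close> is the largest that keeps such a function
        nonnegative. Comparing at \<open>1\<close> suffices, since \<open>h 1\<close> determines
        \<open>c\<close>.\<close>
      let ?g = "\<lambda>n. 1 - (1 / ?T) * ?S n"
      have "?f i 1 \<le> ?g 1" for i
      proof (rule bd_hit_within_le_harmonic)
        show "?g n \<ge> 0" for n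
          using sum_le_suminf[OF True, of "{..<n}"] t0 T0 by (simp add: less_imp_le)
        show "?g n = r n * ?g (n + 1) + l n * ?g (n - 1)" if "n \<ge> 1" for n
          using rl[OF that] r0[OF that] that by (rule harmonic_one_minus_sum_bd_weight)
      qed (use r0 l0 in \<open>auto intro: less_imp_le\<close>)
      then have "h 1 \<le> ?g 1" by (intro LIMSEQ_le_const2[OF lim]) auto
      then have "1 / ?T \<le> c" by (simp add: c_def)
      then show ?thesis using T0 by (simp add: field_simps)
    qed
    ultimately have "c = 1 / ?T" using T0 by (simp add: field_simps)
    moreover have "(\<Sum>j. ?t (j + k)) = ?T - ?S k"
      using True by (rule suminf_minus_initial_segment)
    ultimately show ?thesis using True T0 by (simp add: h diff_divide_distrib)
  next
    case False
    \<comment> \<open>For \<open>c > 0\<close>, nonnegativity of \<open>h\<close> would bound every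
      partial sum by \<open>1 / c\<close>.\<close>
    have "c = 0"
    proof (rule ccontr)
      assume "c \<noteq> 0"
      with c_nonneg have "c > 0" by simp
      then have "?S n \<le> 1 / c" for n using h_nonneg[of n] by (simp add: h field_simps)
      then have "summable ?t"
        by (intro summableI_nonneg_bounded[where x = "1 / c"]) (use t0 in \<open>auto intro: less_imp_le\<close>)
      with False show False by simp
    qed
    then show ?thesis using False by (simp add: h)
  qed
  with lim[of k] show ?thesis by simp
qed

theorem theorem1:
  fixes M :: "'a measure" and X :: "nat \<Rightarrow> 'a \<Rightarrow> nat"
    and r l :: "nat \<Rightarrow> real" and k :: nat
  assumes "k \<ge> 1"
    and "birth_death_chain M r l X"
    and "\<And>n. n \<ge> 1 \<Longrightarrow> r n + l n = 1"
    and "\<And>n. n \<ge> 1 \<Longrightarrow> 0 < r n \<and> r n < 1"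
    and "AE \<omega> in M. X 0 \<omega> = k"
  shows "\<P>(\<omega> in M. \<exists>m. X m \<omega> = 0) =
    (if summable (bd_weight r l)
     then (\<Sum>j. bd_weight r l (j + k)) / (\<Sum>j. bd_weight r l j)
     else 1)"
  using birth_death_chain.bd_hit_within_tendsto[OF assms(2,5)] bd_hit_within_limit[OF assms(3,4)]
  by (rule LIMSEQ_unique)

end
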